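(* Let $m>1$ and let $V:H^2_m\otimes\mathcal{E}\to H^2_m\otimes\mathcal{E}_*$ be an isometric module map for Hilbert spaces $\mathcal{E}$ and $\mathcal{E}_*$. Then there exists an isometry $V_0:\mathcal{E}\to\mathcal{E}_*$ such that $$V(\bm{z}^{\bm{k}}\otimes x)=\bm{z}^{\bm{k}}\otimes V_0x\quad\text{for all }\bm{k}\in\mathbb{N}^m,\ x\in\mathcal{E}.$$ Moreover, $\operatorname{ran}V$ is a reducing submodule of $H^2_m\otimes\mathcal{E}_*$ of the form $H^2_m\otimes(\operatorname{ran}V_0)$.
   Context: $\mathbb{B}^m$ is the open unit ball of $\mathbb{C}^m$. The Drury-Arveson (DA) module $H^2_m$ is the reproducing kernel Hilbert space on $\mathbb{B}^m$ with kernel $K(z,w)=(1-\sum_{i=1}^m z_i\bar w_i)^{-1}$. For a Hilbert space $\mathcal{E}$, $H^2_m\otimes\mathcal{E}$ is identified with the Hilbert space of $\mathcal{E}$-valued holomorphic functions $f(z)=\sum_{\bm{k}\in\mathbb{N}^m}a_{\bm{k}}z^{\bm{k}}$ on $\mathbb{B}^m$ ($a_{\bm k}\in\mathcal{E}$, $0\in\mathbb{N}$) with $\|f\|^2=\sum_{\bm{k}}\|a_{\bm{k}}\|^2/\gamma_{\bm{k}}<\infty$, where $\gamma_{\bm{k}}=\frac{(k_1+\cdots+k_m)!}{k_1!\cdots k_m!}$; $\bm{z}^{\bm{k}}\otimes x$ is the function $z\mapsto z^{\bm{k}}x$. It is a Hilbert module over $\mathbb{C}[z_1,\dots,z_m]$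 with $z_i$ acting as multiplication $M_{z_i}$ by the coordinate function. A module map is a bounded linear operator commuting with the module actions. A submodule is a norm-closed subspace invariant under all $M_{z_i}$; it is reducing if it is also invariant under all adjoints $M_{z_i}^*$. *)

theory Defs
  imports "HOL-Analysis.Analysis"
begin

text \<open>Complex Hilbert spaces. The inner product is linear in its first argument.\<close>

class complex_inner = real_normed_vector +
  fixes scaleC :: "complex \<Rightarrow> 'a \<Rightarrow> 'a"  (infixr "*\<^sub>C" 75)
    and cinner :: "'a \<Rightarrow> 'a \<Rightarrow> complex"
  assumes scaleR_scaleC: "r *\<^sub>R x = complex_of_real r *\<^sub>C x"
    and scaleC_add_right: "c *\<^sub>C (x + y) = c *\<^sub>C x + c *\<^sub>C y"
    and scaleC_add_left: "(c + d) *\<^sub>C x = c *\<^sub>C x + d *\<^sub>C x"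
    and scaleC_scaleC: "c *\<^sub>C d *\<^sub>C x = (c * d) *\<^sub>C x"
    and scaleC_one: "1 *\<^sub>C x = x"
    and cinner_commute: "cinner x y = cnj (cinner y x)"
    and cinner_add_left: "cinner (x + y) w = cinner x w + cinner y w"
    and cinner_scaleC_left: "cinner (c *\<^sub>C x) y = c * cinner x y"
    and cinner_self_nonneg: "0 \<le> Re (cinner x x)"
    and cinner_self_eq_zero: "cinner x x = 0 \<longleftrightarrow> x = 0"
    and norm_eq_sqrt_cinner: "norm x = sqrt (Re (cinner x x))"

class chilbert_space = complex_inner + complete_space

instantiation complex :: chilbert_space
begin

definition scaleC_complex :: "complex \<Rightarrow> complex \<Rightarrow> complex"
  where "scaleC_complex c x = c * x"

definition cinner_complex :: "complex \<Rightarrow> complex \<Rightarrow> complex"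
  where "cinner_complex x y = x * cnj y"

instance
  by standard
    (auto simp: scaleC_complex_def cinner_complex_def scaleR_conv_of_real algebra_simps cmod_def
      power2_eq_square)

end

definition clinear_map :: "('a::complex_inner \<Rightarrow> 'b::complex_inner) \<Rightarrow> bool" where
  "clinear_map T \<longleftrightarrow> (\<forall>x y. T (x + y) = T x + T y) \<and> (\<forall>c x. T (c *\<^sub>C x) = c *\<^sub>C T x)"

definition clinear_isometry :: "('a::complex_inner \<Rightarrow> 'b::complex_inner) \<Rightarrow> bool" where
  "clinear_isometry T \<longleftrightarrow> clinear_map T \<and> (\<forall>x. norm (T x) = norm x)"

definition monomial :: "('m::finite \<Rightarrow> nat) \<Rightarrow> complex ^ 'm \<Rightarrow> complex" where
  "monomial k z = (\<Prod>i\<in>UNIV. (z $ i) ^ k i)"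

definition multinomial :: "('m::finite \<Rightarrow> nat) \<Rightarrow> real" where
  "multinomial k = fact (\<Sum>i\<in>UNIV. k i) / (\<Prod>i\<in>UNIV. fact (k i))"

text \<open>
  A function on the open unit ball is represented by a total function that is \<open>0\<close> off the ball,
  so that equality of functions is equality on the ball. Being the sum of a convergent power series
  on the ball, such a function is automatically holomorphic there.
\<close>

definition has_expansion ::
    "(complex ^ 'm::finite \<Rightarrow> 'e::complex_inner) \<Rightarrow> (('m \<Rightarrow> nat) \<Rightarrow> 'e) \<Rightarrow> bool" where
  "has_expansion f a \<longleftrightarrow>
     (\<forall>z\<in>ball 0 1. ((\<lambda>k. monomial k z *\<^sub>C a k) has_sum f z) UNIV) \<and>
     (\<forall>z. z \<notin> ball 0 1 \<longrightarrow> f z = 0)"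

text \<open>
  \<open>DA F\<close> is the tensor product of the Drury-Arveson module with a closed subspace \<open>F\<close> of
  \<open>'e\<close>, as a space of \<open>F\<close>-valued functions; \<open>DA UNIV\<close> is the one with the whole of \<open>'e\<close>.
\<close>

definition DA :: "'e::complex_inner set \<Rightarrow> (complex ^ 'm::finite \<Rightarrow> 'e) set" where
  "DA F = {f. \<exists>a. has_expansion f a \<and> (\<forall>k. a k \<in> F) \<and>
                 (\<lambda>k. (norm (a k))\<^sup>2 / multinomial k) summable_on UNIV}"

text \<open>The coefficients of a power series on the ball are unique, so \<open>THE\<close> is well-defined here.\<close>

definition DA_coeff ::
    "(complex ^ 'm::finite \<Rightarrow> 'e::complex_inner) \<Rightarrow> ('m \<Rightarrow> nat) \<Rightarrow> 'e" where
  "DA_coeff f = (THE a. has_expansion f a)"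

definition DA_norm :: "(complex ^ 'm::finite \<Rightarrow> 'e::complex_inner) \<Rightarrow> real" where
  "DA_norm f = sqrt (\<Sum>\<^sub>\<infinity>k. (norm (DA_coeff f k))\<^sup>2 / multinomial k)"

definition DA_inner ::
    "(complex ^ 'm::finite \<Rightarrow> 'e::complex_inner) \<Rightarrow> (complex ^ 'm \<Rightarrow> 'e) \<Rightarrow> complex" where
  "DA_inner f g =
     (\<Sum>\<^sub>\<infinity>k. cinner (DA_coeff f k) (DA_coeff g k) / complex_of_real (multinomial k))"

definition monomial_tensor ::
    "('m::finite \<Rightarrow> nat) \<Rightarrow> 'e::complex_inner \<Rightarrow> complex ^ 'm \<Rightarrow> 'e" where
  "monomial_tensor k x = (\<lambda>z. if z \<in> ball 0 1 then monomial k z *\<^sub>C x else 0)"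

text \<open>Since the field is infinite, polynomials are represented by the functions they induce.\<close>

definition polynomial_functions :: "(complex ^ 'm::finite \<Rightarrow> complex) set" where
  "polynomial_functions =
     {p. \<exists>K c. finite K \<and> p = (\<lambda>z. \<Sum>k\<in>K. c k * monomial k z)}"

definition mult_op ::
    "(complex ^ 'm \<Rightarrow> complex) \<Rightarrow> (complex ^ 'm \<Rightarrow> 'e::complex_inner) \<Rightarrow> complex ^ 'm \<Rightarrow> 'e" where
  "mult_op p f = (\<lambda>z. p z *\<^sub>C f z)"

abbreviation coord_mult ::
    "'m \<Rightarrow> (complex ^ 'm \<Rightarrow> 'e::complex_inner) \<Rightarrow> complex ^ 'm \<Rightarrow> 'e" where
  "coord_mult i \<equiv> mult_op (\<lambda>z. z $ i)"

text \<open>Operators are only constrained on the carrier \<open>DA UNIV\<close>.\<close>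

definition DA_bounded_clinear ::
    "((complex ^ 'm::finite \<Rightarrow> 'e::complex_inner) \<Rightarrow> (complex ^ 'm \<Rightarrow> 'f::complex_inner)) \<Rightarrow> bool"
  where
  "DA_bounded_clinear T \<longleftrightarrow>
     (\<forall>f\<in>DA UNIV. T f \<in> DA UNIV) \<and>
     (\<forall>f\<in>DA UNIV. \<forall>g\<in>DA UNIV. T (\<lambda>z. f z + g z) = (\<lambda>z. T f z + T g z)) \<and>
     (\<forall>c. \<forall>f\<in>DA UNIV. T (\<lambda>z. c *\<^sub>C f z) = (\<lambda>z. c *\<^sub>C T f z)) \<and>
     (\<exists>C. \<forall>f\<in>DA UNIV. DA_norm (T f) \<le> C * DA_norm f)"

definition DA_module_map ::
    "((complex ^ 'm::finite \<Rightarrow> 'e::complex_inner) \<Rightarrow> (complex ^ 'm \<Rightarrow> 'f::complex_inner)) \<Rightarrow> bool"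
  where
  "DA_module_map T \<longleftrightarrow> DA_bounded_clinear T \<and>
     (\<forall>p\<in>polynomial_functions. \<forall>f\<in>DA UNIV. T (mult_op p f) = mult_op p (T f))"

definition DA_isometric ::
    "((complex ^ 'm::finite \<Rightarrow> 'e::complex_inner) \<Rightarrow> (complex ^ 'm \<Rightarrow> 'f::complex_inner)) \<Rightarrow> bool"
  where
  "DA_isometric T \<longleftrightarrow> (\<forall>f\<in>DA UNIV. DA_norm (T f) = DA_norm f)"

definition DA_adjoint ::
    "((complex ^ 'm::finite \<Rightarrow> 'e::complex_inner) \<Rightarrow> (complex ^ 'm \<Rightarrow> 'f::complex_inner)) \<Rightarrow>
     (complex ^ 'm \<Rightarrow> 'f) \<Rightarrow> complex ^ 'm \<Rightarrow> 'e" where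
  "DA_adjoint T g = (THE h. h \<in> DA UNIV \<and> (\<forall>f\<in>DA UNIV. DA_inner (T f) g = DA_inner f h))"

definition DA_closed_subspace :: "(complex ^ 'm::finite \<Rightarrow> 'e::complex_inner) set \<Rightarrow> bool" where
  "DA_closed_subspace S \<longleftrightarrow>
     S \<subseteq> DA UNIV \<and> (\<lambda>z. 0) \<in> S \<and>
     (\<forall>f\<in>S. \<forall>g\<in>S. (\<lambda>z. f z + g z) \<in> S) \<and>
     (\<forall>c. \<forall>f\<in>S. (\<lambda>z. c *\<^sub>C f z) \<in> S) \<and>
     (\<forall>s. \<forall>f\<in>DA UNIV. (\<forall>n::nat. s n \<in> S) \<and>
        (\<lambda>n. DA_norm (\<lambda>z. s n z - f z)) \<longlonglongrightarrow> 0 \<longrightarrow> f \<in> S)"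

definition DA_submodule :: "(complex ^ 'm::finite \<Rightarrow> 'e::complex_inner) set \<Rightarrow> bool" where
  "DA_submodule S \<longleftrightarrow> DA_closed_subspace S \<and> (\<forall>i. \<forall>f\<in>S. coord_mult i f \<in> S)"

definition DA_reducing_submodule :: "(complex ^ 'm::finite \<Rightarrow> 'e::complex_inner) set \<Rightarrow> bool" where
  "DA_reducing_submodule S \<longleftrightarrow>
     DA_submodule S \<and> (\<forall>i. \<forall>f\<in>S. DA_adjoint (coord_mult i) f \<in> S)"

end

theory Submission
  imports Defs
begin

text \<open>
  Let \<open>f = V(1 \<otimes> x)\<close> have coefficients \<open>a\<^sub>k\<close>. In the Drury-Arveson norm multiplication by one
  coordinate preserves the norm of constants, so the isometric module map \<open>V\<close> gives
  \<open>\<parallel>z\<^sub>i f\<parallel> = \<parallel>z\<^sub>i \<otimes> x\<parallel> = \<parallel>x\<parallel> = \<parallel>f\<parallel>\<close> for each of the \<open>m\<close> coordinates. On the other hand,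
  the reciprocal weights of the \<open>m\<close> exponents that arise from \<open>k\<close> by raising one entry by one add up to
  \<open>(\<bar>k\<bar> + m) / ((\<bar>k\<bar> + 1) \<gamma>\<^sub>k)\<close> (\<open>sum_inverse_multinomial_incr\<close>), whence
  \<open>m \<parallel>f\<parallel>\<^sup>2 = \<Sum>\<^sub>i \<parallel>z\<^sub>i f\<parallel>\<^sup>2 = \<Sum>\<^sub>k (\<bar>k\<bar> + m) / (\<bar>k\<bar> + 1) \<parallel>a\<^sub>k\<parallel>\<^sup>2 / \<gamma>\<^sub>k\<close>.
  For \<open>m > 1\<close> the factor is smaller than \<open>m\<close> unless \<open>k = 0\<close>, so all other coefficients vanish
  (\<open>DA_coeff_eq_0_if_coord_mult_isometric\<close>) and \<open>f\<close> is a constant \<open>1 \<otimes> V\<^sub>0 x\<close>. The formula for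
  \<open>V(z\<^sup>k \<otimes> x)\<close> follows because \<open>V\<close> is a module map.

  By density of polynomials \<open>V\<close> acts on all coefficients by \<open>V\<^sub>0\<close> (\<open>DA_coeff_bounded_clinear\<close>).
  Consequently the range of \<open>V\<close> consists of the functions with coefficients in \<open>ran V\<^sub>0\<close>, a closed
  subspace since \<open>V\<^sub>0\<close> is isometric on a complete space. Functions with coefficients in a fixed closed subspace form a
  reducing submodule, as the coordinate multiplications and their adjoints are weighted shifts of
  the coefficients (\<open>DA_reducing_submodule_DA\<close>).

  Two facts make coefficients usable: a function on the ball determines its coefficients
  (\<open>has_expansion_unique\<close>), and every square-summable family is the coefficient family of a function
  (\<open>has_expansion_power_series\<close>).
\<close>

section \<open>Complex inner product spaces\<close>

lemma scaleC_zero_left [simp]: "0 *\<^sub>C x = (0 :: 'a::complex_inner)"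
  using scaleC_add_left[of 0 0 x] by simp

lemma scaleC_zero_right [simp]: "c *\<^sub>C 0 = (0 :: 'a::complex_inner)"
  using scaleC_add_right[of c 0 0] by simp

lemma scaleC_minus_one: "(- 1) *\<^sub>C x = - (x :: 'a::complex_inner)"
  using scaleR_scaleC[of "- 1" x] by simp

lemma cinner_add_right: "cinner w (x + y) = cinner w x + cinner w (y :: 'a::complex_inner)"
  by (metis cinner_add_left cinner_commute complex_cnj_add)

lemma cinner_scaleC_right: "cinner x (c *\<^sub>C y) = cnj c * cinner x (y :: 'a::complex_inner)"
  by (metis cinner_scaleC_left cinner_commute complex_cnj_mult)

lemma cinner_minus_left: "cinner (- x) w = - cinner x (w :: 'a::complex_inner)"
  using cinner_scaleC_left[of "- 1" x w] by (simp add: scaleC_minus_one)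

lemma cinner_minus_right: "cinner w (- x) = - cinner w (x :: 'a::complex_inner)"
  using cinner_scaleC_right[of w "- 1" x] by (simp add: scaleC_minus_one)

lemma cinner_diff_left: "cinner (x - y) w = cinner x w - cinner y (w :: 'a::complex_inner)"
  using cinner_add_left[of x "- y" w] by (simp add: cinner_minus_left)

lemma cinner_diff_right: "cinner w (x - y) = cinner w x - cinner w (y :: 'a::complex_inner)"
  using cinner_add_right[of w x "- y"] by (simp add: cinner_minus_right)

lemma cinner_zero [simp]: "cinner 0 w = 0" "cinner w (0 :: 'a::complex_inner) = 0"
  using cinner_scaleC_left[of 0 0 w] cinner_scaleC_right[of w 0 0] by simp_all

lemma cinner_self: "cinner x x = complex_of_real ((norm (x :: 'a::complex_inner))\<^sup>2)"
proof (rule complex_eqI)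
  show "Re (cinner x x) = Re (complex_of_real ((norm x)\<^sup>2))"
    by (simp add: norm_eq_sqrt_cinner cinner_self_nonneg)
  have "Im (cinner x x) = - Im (cinner x x)"
    by (metis cinner_commute complex_cnj cnj.sel(2))
  then show "Im (cinner x x) = Im (complex_of_real ((norm x)\<^sup>2))" by simp
qed

lemma norm_scaleC: "norm (c *\<^sub>C x) = cmod c * norm (x :: 'a::complex_inner)"
proof -
  have "complex_of_real ((norm (c *\<^sub>C x))\<^sup>2) = complex_of_real ((cmod c * norm x)\<^sup>2)"
    by (metis cinner_self cinner_scaleC_left cinner_scaleC_right complex_norm_square mult.assoc
        of_real_mult power_mult_distrib)
  then have "(norm (c *\<^sub>C x))\<^sup>2 = (cmod c * norm x)\<^sup>2"
    by (simp only: of_real_eq_iff)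
  then show ?thesis by (simp add: power2_eq_iff_nonneg)
qed

lemma norm_cinner_le: "cmod (cinner x y) \<le> norm x * norm (y :: 'a::complex_inner)"
proof (cases "y = 0")
  case False
  define c where "c = cinner x y / complex_of_real ((norm y)\<^sup>2)"
  have n: "complex_of_real ((norm y)\<^sup>2) \<noteq> 0" using False by simp
  have "cinner (x - c *\<^sub>C y) y = 0"
    using n by (simp add: cinner_diff_left cinner_scaleC_left cinner_self c_def)
  then have "cinner (x - c *\<^sub>C y) (x - c *\<^sub>C y) = cinner x x - c * cinner y x"
    by (simp add: cinner_diff_right cinner_scaleC_right cinner_diff_left cinner_scaleC_left)
  also have "c * cinner y x = complex_of_real ((cmod (cinner x y))\<^sup>2 / (norm y)\<^sup>2)"
    by (subst cinner_commute[of y x]) (simp add: c_def complex_norm_square del: of_real_power)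
  finally have "complex_of_real ((norm (x - c *\<^sub>C y))\<^sup>2) =
      complex_of_real ((norm x)\<^sup>2 - (cmod (cinner x y))\<^sup>2 / (norm y)\<^sup>2)"
    by (simp only: cinner_self of_real_diff)
  then have "(norm (x - c *\<^sub>C y))\<^sup>2 = (norm x)\<^sup>2 - (cmod (cinner x y))\<^sup>2 / (norm y)\<^sup>2"
    by (simp only: of_real_eq_iff)
  then have "(cmod (cinner x y))\<^sup>2 / (norm y)\<^sup>2 \<le> (norm x)\<^sup>2"
    by (metis diff_ge_0_iff_ge zero_le_power2)
  then have "(cmod (cinner x y))\<^sup>2 \<le> (norm x * norm y)\<^sup>2"
    using False by (simp add: divide_le_eq power_mult_distrib)
  then show ?thesis by (rule power2_le_imp_le) simp
qed simp

lemma bounded_linear_cinner_left: "bounded_linear (\<lambda>x. cinner x (w :: 'a::complex_inner))"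
  by (rule bounded_linear_intro[where K = "norm w"])
    (simp_all add: cinner_add_left scaleR_scaleC cinner_scaleC_left norm_cinner_le
      scaleC_complex_def)

lemma bounded_linear_scaleC: "bounded_linear (\<lambda>x. c *\<^sub>C (x :: 'a::complex_inner))"
  by (rule bounded_linear_intro[where K = "cmod c"])
    (simp_all add: scaleC_add_right scaleR_scaleC scaleC_scaleC norm_scaleC mult.commute)

instance chilbert_space \<subseteq> banach ..

section \<open>Uniqueness of power series coefficients\<close>

text \<open>
  If the coefficients below \<open>n\<close> vanish, division by \<open>t\<^sup>n\<close> leaves a power series with constant term
  \<open>A n\<close> whose sum still vanishes off the origin, and its limit at \<open>0\<close> is \<open>A n\<close>.
\<close>

lemma power_series_coeffs_eq_zero:
  fixes A :: "nat \<Rightarrow> complex"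
  assumes "\<And>t. t \<noteq> 0 \<Longrightarrow> norm t < 1 \<Longrightarrow> (\<lambda>n. A n * t ^ n) sums 0"
  shows "A n = 0"
proof (induction n rule: less_induct)
  case (less n)
  have "(\<lambda>j. A (j + n) * t ^ j) sums 0" if t: "t \<noteq> 0" "norm t < 1" for t
  proof -
    have "(\<lambda>j. A (j + n) * t ^ (j + n)) sums (0 - (\<Sum>j<n. A j * t ^ j))"
      using assms[OF t] by (rule sums_split_initial_segment)
    then have "(\<lambda>j. (A (j + n) * t ^ (j + n)) * inverse (t ^ n)) sums (0 * inverse (t ^ n))"
      using less by (intro sums_mult2) simp
    then show ?thesis using t by (simp add: power_add mult.assoc)
  qed
  then have "((\<lambda>t. 0) \<longlongrightarrow> A (0 + n)) (at (0::complex))"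
    by (intro powser_limit_0_strong[of 1 "\<lambda>j. A (j + n)"]) auto
  then show ?case
    by (metis add_0 tendsto_unique tendsto_const at_neq_bot)
qed

lemma monomial_scale_coordinate:
  "monomial k (\<chi> j. if j = i then t * z $ j else z $ j) = t ^ k i * monomial k z"
proof -
  have "monomial k (\<chi> j. if j = i then t * z $ j else z $ j) =
      (\<Prod>j\<in>UNIV. (if j = i then t ^ k j else 1) * (z $ j) ^ k j)"
    unfolding monomial_def by (rule prod.cong) (auto simp: power_mult_distrib)
  also have "\<dots> = t ^ k i * monomial k z"
    by (simp add: prod.distrib monomial_def)
  finally show ?thesis .
qed

text \<open>
  Replacing the coordinate \<open>z\<^sub>i\<close> by \<open>t z\<^sub>i\<close> turns the sum into a power series in \<open>t\<close>, whose
  coefficients are the partial sums over fixed \<open>k\<^sub>i\<close>. Fixing the exponents one after the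
  other in this way isolates a single coefficient.
\<close>

lemma scalar_expansion_zero_unique:
  fixes c :: "('m::finite \<Rightarrow> nat) \<Rightarrow> complex"
  assumes zero: "\<And>z. z \<in> ball 0 1 \<Longrightarrow> ((\<lambda>k. monomial k z * c k) has_sum 0) UNIV"
  shows "c k = 0"
proof -
  have partial: "((\<lambda>k. monomial k z * c k) has_sum 0) {k. \<forall>i\<in>S. k i = l i}"
    if "finite S" "z \<in> ball 0 1" for S l and z :: "complex ^ 'm"
    using that
  proof (induction S arbitrary: z rule: finite_induct)
    case empty
    then show ?case using zero by simp
  next
    case (insert i S)
    define B where "B n = {k. (\<forall>j\<in>S. k j = l j) \<and> k i = n}" for n
    define h where "h = (\<lambda>k. monomial k z * c k)"
    define A where "A n = infsum h (B n)" for n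
    have "h summable_on {k. \<forall>j\<in>S. k j = l j}"
      using has_sum_imp_summable[OF insert.IH[OF insert.prems]] 
      by (simp add: h_def)
    then have "h summable_on B n" for n
      by (rule summable_on_subset_banach) (auto simp: B_def)
    then have hB: "(h has_sum A n) (B n)" for n
      by (simp add: A_def has_sum_infsum)
    have "(\<lambda>n. A n * t ^ n) sums 0" if t: "t \<noteq> 0" "norm t < 1" for t
    proof -
      let ?z = "\<chi> j. if j = i then t * z $ j else z $ j"
      have "norm ?z \<le> norm z"
      proof (rule norm_le_componentwise_cart)
        fix j
        show "norm (?z $ j) \<le> norm (z $ j)"
          using t by (simp add: norm_mult mult_left_le_one_le)
      qed
      then have "?z \<in> ball 0 1" using insert.prems by simp
      from insert.IH[OF this]
      have "((\<lambda>k. t ^ k i * h k) has_sum 0) {k. \<forall>j\<in>S. k j = l j}"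
        by (simp add: monomial_scale_coordinate h_def mult.assoc)
      also have "?this \<longleftrightarrow> ((\<lambda>(n, k). h k * t ^ n) has_sum 0) (Sigma UNIV B)"
        by (rule has_sum_reindex_bij_witness[of _ snd "\<lambda>k. (k i, k)"])
          (auto simp: B_def mult.commute)
      finally have "((\<lambda>n. A n * t ^ n) has_sum 0) UNIV"
        by (rule has_sum_Sigma') (auto intro!: has_sum_cmult_left hB)
      then show ?thesis by (rule has_sum_imp_sums)
    qed
    then have "A (l i) = 0" by (rule power_series_coeffs_eq_zero)
    moreover have "B (l i) = {k. \<forall>j\<in>insert i S. k j = l j}" by (auto simp: B_def)
    ultimately show ?case using hB[of "l i"] by (simp add: h_def)
  qed
  \<comment> \<open>A point of the ball without vanishing coordinates, where no monomial vanishes.\<close>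
  define r where "r = 1 / (2 * real CARD('m))"
  define z :: "complex ^ 'm" where "z = (\<chi> i. complex_of_real r)"
  have r: "r > 0" by (simp add: r_def)
  have "norm z \<le> (\<Sum>i\<in>UNIV. norm (z $ i))" unfolding norm_vec_def by (rule L2_set_le_sum) simp
  also have "\<dots> = 1 / 2" using r by (simp add: z_def) (simp add: r_def)
  finally have "z \<in> ball 0 1" by simp
  moreover have "{k'. \<forall>i\<in>UNIV. k' i = k i} = {k}" by auto
  ultimately have "((\<lambda>k. monomial k z * c k) has_sum 0) {k}"
    using partial[of UNIV z k] by simp
  then have "monomial k z * c k = 0"
    using has_sum_unique[OF has_sum_finite[of "{k}"]] by fastforce
  moreover have "monomial k z \<noteq> 0" using r by (simp add: monomial_def z_def)
  ultimately show ?thesis by simp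
qed

text \<open>
  Unconditional convergence in an infinite-dimensional space does not give absolute convergence;
  pairing with a fixed vector reduces the claim to scalar coefficients, where it does.
\<close>

lemma has_expansion_unique:
  fixes f :: "complex ^ 'm::finite \<Rightarrow> 'e::complex_inner"
  assumes "has_expansion f a" "has_expansion f b"
  shows "a = b"
proof
  fix k
  define w where "w = a k - b k"
  have "((\<lambda>k. monomial k z * (cinner (a k) w - cinner (b k) w)) has_sum 0) UNIV"
    if "z \<in> ball 0 1" for z
  proof -
    have "((\<lambda>k. cinner (monomial k z *\<^sub>C a k) w) has_sum cinner (f z) w) UNIV"
      "((\<lambda>k. cinner (monomial k z *\<^sub>C b k) w) has_sum cinner (f z) w) UNIV"
      using assms that
      by (auto simp: has_expansion_def intro!: has_sum_bounded_linear[OF bounded_linear_cinner_left])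
    from has_sum_add[OF this(1) has_sum_uminusI[OF this(2)]] show ?thesis
      by (simp add: cinner_scaleC_left algebra_simps)
  qed
  then have "cinner (a k) w - cinner (b k) w = 0"
    by (rule scalar_expansion_zero_unique)
  then have "cinner w w = 0" by (simp add: w_def cinner_diff_left)
  then show "a k = b k" by (simp add: cinner_self_eq_zero w_def)
qed

lemma DA_coeff_eq: "has_expansion f a \<Longrightarrow> DA_coeff f = a"
  unfolding DA_coeff_def by (blast intro: the_equality has_expansion_unique)

section \<open>The weights\<close>

abbreviation incr :: "'m \<Rightarrow> ('m \<Rightarrow> nat) \<Rightarrow> 'm \<Rightarrow> nat" where
  "incr i k \<equiv> k(i := Suc (k i))"

abbreviation decr :: "'m \<Rightarrow> ('m \<Rightarrow> nat) \<Rightarrow> 'm \<Rightarrow> nat" where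
  "decr i k \<equiv> k(i := k i - 1)"

definition total_degree :: "('m::finite \<Rightarrow> nat) \<Rightarrow> nat" where
  "total_degree k = (\<Sum>i\<in>UNIV. k i)"

lemma inj_incr: "inj (incr i)"
  by (rule inj_on_inverseI[where g = "decr i"]) simp

lemma range_incr: "range (incr i) = {k. k i \<noteq> 0}"
proof -
  have "k \<in> range (incr i)" if "k i \<noteq> 0" for k
    using that by (intro image_eqI[of _ _ "decr i k"]) auto
  then show ?thesis by auto
qed

lemma total_degree_incr [simp]: "total_degree (incr i k) = Suc (total_degree k)"
proof -
  have "total_degree (incr i k) = (\<Sum>j\<in>UNIV. k j + (if j = i then 1 else 0))"
    unfolding total_degree_def by (rule sum.cong) auto
  then show ?thesis by (simp add: sum.distrib total_degree_def)
qed

text \<open>Used for \<open>g j n = z\<^sub>j\<^sup>n\<close> and for \<open>g j n = n!\<close>.\<close>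

lemma prod_incr:
  fixes g :: "'m::finite \<Rightarrow> nat \<Rightarrow> 'a::comm_monoid_mult"
  assumes "g i (Suc (k i)) = c * g i (k i)"
  shows "(\<Prod>j\<in>UNIV. g j (incr i k j)) = c * (\<Prod>j\<in>UNIV. g j (k j))"
proof -
  have "(\<Prod>j\<in>UNIV. g j (incr i k j)) = (\<Prod>j\<in>UNIV. (if j = i then c else 1) * g j (k j))"
    by (rule prod.cong) (auto simp: assms)
  then show ?thesis by (simp add: prod.distrib)
qed

lemma total_degree_eq_0_iff: "total_degree k = 0 \<longleftrightarrow> k = (\<lambda>_. 0)"
  by (auto simp: total_degree_def)

lemma finite_total_degree: "finite {k :: 'm::finite \<Rightarrow> nat. total_degree k = n}"
proof (rule finite_subset)
  show "{k :: 'm \<Rightarrow> nat. total_degree k = n} \<subseteq> PiE UNIV (\<lambda>_. {..n})"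
    by (auto simp: total_degree_def intro!: member_le_sum)
qed (simp add: finite_PiE)

lemma monomial_incr: "monomial (incr i k) z = z $ i * monomial k z"
  unfolding monomial_def by (rule prod_incr) simp

lemma monomial_zero [simp]: "monomial (\<lambda>_. 0) z = 1"
  by (simp add: monomial_def)

lemma multinomial_zero [simp]: "multinomial (\<lambda>_. 0) = 1"
  by (simp add: multinomial_def)

lemma multinomial_pos [simp]: "multinomial k > 0"
  by (simp add: multinomial_def prod_pos)

lemma multinomial_nonneg [simp]: "multinomial k \<ge> 0"
  using multinomial_pos[of k] by linarith

lemma multinomial_nonzero [simp]: "multinomial k \<noteq> 0"
  using multinomial_pos[of k] by linarith

lemma multinomial_incr:
  "multinomial (incr i k) = multinomial k * (real (total_degree k) + 1) / (real (k i) + 1)"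
proof -
  have "(\<Prod>j\<in>UNIV. fact (incr i k j)) = (real (k i) + 1) * (\<Prod>j\<in>UNIV. fact (k j))"
    by (rule prod_incr) (simp add: algebra_simps)
  moreover have "fact (\<Sum>j\<in>UNIV. incr i k j) = (real (total_degree k) + 1) * fact (total_degree k)"
    using total_degree_incr[of k i] by (simp add: total_degree_def algebra_simps)
  ultimately show ?thesis by (simp add: multinomial_def total_degree_def ac_simps)
qed

lemma multinomial_le_incr: "multinomial k \<le> multinomial (incr i k)"
proof -
  have "k i \<le> total_degree k"
    by (simp add: total_degree_def member_le_sum)
  then have "multinomial k * 1 \<le> multinomial k * ((real (total_degree k) + 1) / (real (k i) + 1))"
    by (intro mult_left_mono) simp_all
  then show ?thesis by (simp add: multinomial_incr)
qed

text \<open>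
  The squared norms of \<open>z\<^sub>i z\<^sup>k\<close>, summed over \<open>i\<close>, are the squared norm of \<open>z\<^sup>k\<close> times
  \<open>(\<bar>k\<bar> + m) / (\<bar>k\<bar> + 1)\<close>. This factor is \<open>m\<close> for constants and, when \<open>m > 1\<close>, smaller than
  \<open>m\<close> in every positive degree.
\<close>

lemma sum_inverse_multinomial_incr:
  "(\<Sum>i\<in>UNIV. 1 / multinomial (incr i k)) =
    (real (total_degree k) + real CARD('m)) / ((real (total_degree k) + 1) * multinomial k)"
  for k :: "'m::finite \<Rightarrow> nat"
proof -
  have "(\<Sum>i\<in>UNIV. 1 / multinomial (incr i k)) =
      (\<Sum>i\<in>UNIV. (real (k i) + 1) / ((real (total_degree k) + 1) * multinomial k))"
    by (simp add: multinomial_incr mult.commute)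
  also have "\<dots> = (\<Sum>i\<in>UNIV. real (k i) + 1) / ((real (total_degree k) + 1) * multinomial k)"
    by (simp add: sum_divide_distrib)
  finally show ?thesis by (simp add: sum.distrib total_degree_def)
qed

text \<open>
  Pascal's rule: a word with \<open>k\<^sub>i\<close> letters \<open>i\<close> arises from its last letter and the word
  before it.
\<close>

lemma multinomial_eq_sum_decr:
  assumes "k \<noteq> (\<lambda>_. 0)"
  shows "multinomial k = (\<Sum>i | k i \<noteq> 0. multinomial (decr i k))"
proof -
  have deg: "total_degree k > 0"
    using assms by (metis gr0I total_degree_eq_0_iff)
  have "multinomial (decr i k) = multinomial k * real (k i) / real (total_degree k)"
    if "k i \<noteq> 0" for i
  proof -
    have *: "incr i (decr i k) = k" using that by auto
    have "total_degree k = Suc (total_degree (decr i k))"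
      using total_degree_incr[of "decr i k" i] unfolding * .
    then show ?thesis
      using multinomial_incr[of "decr i k" i] that unfolding * by (simp add: ac_simps)
  qed
  then have "(\<Sum>i | k i \<noteq> 0. multinomial (decr i k)) =
      (\<Sum>i | k i \<noteq> 0. multinomial k * real (k i) / real (total_degree k))"
    by simp
  also have "\<dots> = (\<Sum>i\<in>UNIV. multinomial k * real (k i) / real (total_degree k))"
    by (rule sum.mono_neutral_left) auto
  also have "\<dots> = multinomial k * (\<Sum>i\<in>UNIV. real (k i)) / real (total_degree k)"
    by (simp add: sum_divide_distrib sum_distrib_left)
  also have "\<dots> = multinomial k"
  proof -
    have "(\<Sum>i\<in>UNIV. real (k i)) = real (total_degree k)"
      by (simp add: total_degree_def)
    then show ?thesis using deg by simp
  qed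
  finally show ?thesis by (rule sym)
qed

lemma multinomial_theorem:
  fixes t :: "'m::finite \<Rightarrow> real"
  shows "(\<Sum>k | total_degree k = n. multinomial k * (\<Prod>i\<in>UNIV. t i ^ k i)) = (\<Sum>i\<in>UNIV. t i) ^ n"
proof (induction n)
  case 0
  have "{k :: 'm \<Rightarrow> nat. total_degree k = 0} = {\<lambda>_. 0}"
    by (auto simp: total_degree_eq_0_iff)
  then show ?case by simp
next
  case (Suc n)
  define p where "p k = (\<Prod>i\<in>UNIV. t i ^ k i)" for k
  have p: "p (incr i k) = t i * p k" for i k
    unfolding p_def by (rule prod_incr) simp
  have "(\<Sum>k | total_degree k = Suc n. multinomial k * p k) =
      (\<Sum>k | total_degree k = Suc n. \<Sum>i | k i \<noteq> 0. multinomial (decr i k) * p k)"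
  proof (rule sum.cong)
    fix k :: "'m \<Rightarrow> nat" assume "k \<in> {k. total_degree k = Suc n}"
    then have "k \<noteq> (\<lambda>_. 0)" by (auto simp: total_degree_def)
    then show "multinomial k * p k = (\<Sum>i | k i \<noteq> 0. multinomial (decr i k) * p k)"
      by (simp add: multinomial_eq_sum_decr sum_distrib_right)
  qed simp
  also have "\<dots> = (\<Sum>i\<in>UNIV. \<Sum>k | total_degree k = Suc n \<and> k i \<noteq> 0. multinomial (decr i k) * p k)"
    using sum.swap_restrict[of "{k :: 'm \<Rightarrow> nat. total_degree k = Suc n}" UNIV
        "\<lambda>k i. multinomial (decr i k) * p k" "\<lambda>k i. k i \<noteq> 0"]
    by (simp add: finite_total_degree)
  also have "\<dots> = (\<Sum>i\<in>UNIV. \<Sum>k | total_degree k = n. t i * (multinomial k * p k))"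
  proof (rule sum.cong)
    fix i
    have *: "incr i (decr i k) = k" if "k i \<noteq> 0" for k :: "'m \<Rightarrow> nat" using that by auto
    show "(\<Sum>k | total_degree k = Suc n \<and> k i \<noteq> 0. multinomial (decr i k) * p k) =
        (\<Sum>k | total_degree k = n. t i * (multinomial k * p k))"
    proof (rule sum.reindex_bij_witness[of _ "incr i" "decr i"])
      fix k assume k: "k \<in> {k. total_degree k = Suc n \<and> k i \<noteq> 0}"
      then show "decr i k \<in> {k. total_degree k = n}"
        using total_degree_incr[of "decr i k" i] *[of k] by simp
      show "t i * (multinomial (decr i k) * p (decr i k)) = multinomial (decr i k) * p k"
        using p[of "decr i k" i] *[of k] k by simp
    qed auto
  qed simp
  also have "\<dots> = (\<Sum>i\<in>UNIV. t i) ^ Suc n"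
    using Suc by (simp add: p_def sum_distrib_right flip: sum_distrib_left)
  finally show ?case by (simp add: p_def)
qed

text \<open>
  By the multinomial theorem the terms of degree \<open>n\<close> add up to \<open>\<parallel>z\<parallel>\<^sup>2\<^sup>n\<close>, so the sum is a geometric
  series. Its value is the reproducing kernel \<open>1 / (1 - \<parallel>z\<parallel>\<^sup>2)\<close> on the diagonal.
\<close>

lemma summable_multinomial_monomial:
  fixes z :: "complex ^ 'm::finite"
  assumes "z \<in> ball 0 1"
  shows "(\<lambda>k. multinomial k * (cmod (monomial k z))\<^sup>2) summable_on UNIV"
proof (rule nonneg_bdd_above_summable_on)
  define s where "s = (\<Sum>i\<in>UNIV. (cmod (z $ i))\<^sup>2)"
  have "s = (norm z)\<^sup>2"
    by (simp add: s_def norm_vec_def L2_set_def sum_nonneg)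
  then have s: "0 \<le> s" "s < 1"
    using assms by (simp_all add: power_less_one_iff abs_square_less_1)
  have mono: "(cmod (monomial k z))\<^sup>2 = (\<Prod>i\<in>UNIV. ((cmod (z $ i))\<^sup>2) ^ k i)" for k
    unfolding monomial_def prod_norm[symmetric] norm_power prod_power_distrib
    by (rule prod.cong) (simp_all add: power_mult[symmetric] mult.commute)
  show "bdd_above (sum (\<lambda>k. multinomial k * (cmod (monomial k z))\<^sup>2) ` {F. F \<subseteq> UNIV \<and> finite F})"
  proof (rule bdd_aboveI2)
    fix F :: "('m \<Rightarrow> nat) set" assume F: "F \<in> {F. F \<subseteq> UNIV \<and> finite F}"
    define N where "N = (\<Sum>k\<in>F. total_degree k)"
    let ?H = "\<lambda>n. {k :: 'm \<Rightarrow> nat. total_degree k = n}"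
    have "F \<subseteq> (\<Union>n\<le>N. ?H n)"
      using F by (auto simp: N_def member_le_sum)
    then have "(\<Sum>k\<in>F. multinomial k * (cmod (monomial k z))\<^sup>2) \<le>
        (\<Sum>k\<in>(\<Union>n\<le>N. ?H n). multinomial k * (cmod (monomial k z))\<^sup>2)"
      by (intro sum_mono2) (auto simp: finite_total_degree)
    also have "\<dots> = (\<Sum>n\<le>N. \<Sum>k\<in>?H n. multinomial k * (cmod (monomial k z))\<^sup>2)"
      by (rule sum.UNION_disjoint) (auto simp: finite_total_degree)
    also have "\<dots> = (\<Sum>n\<le>N. s ^ n)"
      by (simp add: mono multinomial_theorem s_def)
    also have "\<dots> \<le> (\<Sum>n. s ^ n)"
      using s by (intro sum_le_suminf summable_geometric) auto
    finally show "(\<Sum>k\<in>F. multinomial k * (cmod (monomial k z))\<^sup>2) \<le> (\<Sum>n. s ^ n)" .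
  qed
qed simp

section \<open>Expansions and square-summable coefficients\<close>

definition DA_sequence :: "(('m::finite \<Rightarrow> nat) \<Rightarrow> 'e::complex_inner) \<Rightarrow> bool" where
  "DA_sequence a \<longleftrightarrow> (\<lambda>k. (norm (a k))\<^sup>2 / multinomial k) summable_on UNIV"

definition power_series ::
    "(('m::finite \<Rightarrow> nat) \<Rightarrow> 'e::complex_inner) \<Rightarrow> complex ^ 'm \<Rightarrow> 'e" where
  "power_series a z = (if z \<in> ball 0 1 then \<Sum>\<^sub>\<infinity>k. monomial k z *\<^sub>C a k else 0)"

text \<open>
  With \<open>r = sqrt \<gamma>\<^sub>k\<close>, each term \<open>z\<^sup>k a\<^sub>k\<close> is the product of \<open>r z\<^sup>k\<close> and \<open>a\<^sub>k / r\<close>. Both families are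
  square-summable, so the series converges absolutely at every point of the ball.
\<close>

lemma has_expansion_power_series:
  fixes a :: "('m::finite \<Rightarrow> nat) \<Rightarrow> 'e::chilbert_space"
  assumes "DA_sequence a"
  shows "has_expansion (power_series a) a"
proof -
  have "(\<lambda>k. monomial k z *\<^sub>C a k) summable_on UNIV" if z: "z \<in> ball 0 1" for z
  proof (rule abs_summable_summable, rule summable_on_comparison_test)
    show "(\<lambda>k. multinomial k * (cmod (monomial k z))\<^sup>2 + (norm (a k))\<^sup>2 / multinomial k)
        summable_on UNIV"
      using summable_on_add[OF summable_multinomial_monomial[OF z] assms[unfolded DA_sequence_def]] .
    show "norm (monomial k z *\<^sub>C a k) \<le>
        multinomial k * (cmod (monomial k z))\<^sup>2 + (norm (a k))\<^sup>2 / multinomial k" for k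
    proof -
      define r where "r = sqrt (multinomial k)"
      have r: "r > 0" "r\<^sup>2 = multinomial k" by (simp_all add: r_def)
      have "cmod (monomial k z) * norm (a k) = (r * cmod (monomial k z)) * (norm (a k) / r)"
        using r by simp
      also have "\<dots> \<le> 2 * (r * cmod (monomial k z)) * (norm (a k) / r)"
        using r by simp
      also have "\<dots> \<le> (r * cmod (monomial k z))\<^sup>2 + (norm (a k) / r)\<^sup>2"
        by (rule sum_squares_bound)
      finally show ?thesis
        by (simp add: norm_scaleC power_mult_distrib power_divide r(2))
    qed
  qed simp
  then show ?thesis
    by (simp add: has_expansion_def power_series_def has_sum_infsum)
qed

lemma has_expansion_zero: "has_expansion (\<lambda>z. 0) (\<lambda>k. 0)"
  by (simp add: has_expansion_def)

lemma has_expansion_add: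
  "has_expansion f a \<Longrightarrow> has_expansion g b \<Longrightarrow> has_expansion (\<lambda>z. f z + g z) (\<lambda>k. a k + b k)"
  by (simp add: has_expansion_def scaleC_add_right has_sum_add)

lemma has_expansion_scaleC:
  assumes "has_expansion f a"
  shows "has_expansion (\<lambda>z. c *\<^sub>C f z) (\<lambda>k. c *\<^sub>C a k)"
proof -
  have "((\<lambda>k. c *\<^sub>C (monomial k z *\<^sub>C a k)) has_sum c *\<^sub>C f z) UNIV" if "z \<in> ball 0 1" for z
    using assms that
    by (intro has_sum_bounded_linear[OF bounded_linear_scaleC]) (simp add: has_expansion_def)
  then show ?thesis
    using assms by (simp add: has_expansion_def scaleC_scaleC mult.commute)
qed

lemma has_expansion_diff:
  "has_expansion f a \<Longrightarrow> has_expansion g b \<Longrightarrow> has_expansion (\<lambda>z. f z - g z) (\<lambda>k. a k - b k)"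
  using has_expansion_add[OF _ has_expansion_scaleC[of g b "- 1"], of f a]
  by (simp add: scaleC_minus_one)

lemma has_expansion_monomial_tensor:
  "has_expansion (monomial_tensor k x) (\<lambda>j. if j = k then x else 0)"
proof -
  have "((\<lambda>j. monomial j z *\<^sub>C (if j = k then x else 0)) has_sum monomial k z *\<^sub>C x) UNIV" for z
    by (rule has_sum_finite_neutralI[of "{k}"]) auto
  then show ?thesis by (simp add: has_expansion_def monomial_tensor_def)
qed

lemma DA_sequence_scaleC: "DA_sequence a \<Longrightarrow> DA_sequence (\<lambda>k. c *\<^sub>C a k)"
  unfolding DA_sequence_def
  by (drule summable_on_cmult_right[of _ _ "(cmod c)\<^sup>2"])
    (simp add: norm_scaleC power_mult_distrib)

lemma DA_sequence_add:
  assumes "DA_sequence a" "DA_sequence b"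
  shows "DA_sequence (\<lambda>k. a k + b k)"
  unfolding DA_sequence_def
proof (rule summable_on_comparison_test)
  show "(\<lambda>k. 2 * ((norm (a k))\<^sup>2 / multinomial k) + 2 * ((norm (b k))\<^sup>2 / multinomial k))
      summable_on UNIV"
    using assms unfolding DA_sequence_def by (intro summable_on_add summable_on_cmult_right)
  fix k
  have "(norm (a k + b k))\<^sup>2 \<le> (norm (a k) + norm (b k))\<^sup>2"
    by (intro power_mono norm_triangle_ineq) simp
  also have "\<dots> \<le> 2 * (norm (a k))\<^sup>2 + 2 * (norm (b k))\<^sup>2"
    using sum_squares_bound[of "norm (a k)" "norm (b k)"] by (simp add: power2_sum)
  finally have "(norm (a k + b k))\<^sup>2 / multinomial k \<le>
      (2 * (norm (a k))\<^sup>2 + 2 * (norm (b k))\<^sup>2) / multinomial k"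
    by (rule divide_right_mono) simp
  then show "(norm (a k + b k))\<^sup>2 / multinomial k \<le>
      2 * ((norm (a k))\<^sup>2 / multinomial k) + 2 * ((norm (b k))\<^sup>2 / multinomial k)"
    by (simp add: add_divide_distrib)
qed simp

lemma DA_sequence_single: "DA_sequence (\<lambda>j. if j = k then x else 0)"
  unfolding DA_sequence_def
  by (rule finite_nonzero_values_imp_summable_on, rule finite_subset[of _ "{k}"]) auto

lemma DA_sequence_le:
  assumes "DA_sequence a" "\<And>k. norm (b k) \<le> norm (a k)"
  shows "DA_sequence b"
  using assms(1) unfolding DA_sequence_def
  by (rule summable_on_comparison_test) (auto intro!: divide_right_mono power_mono assms(2))

section \<open>Functions of the Drury-Arveson module\<close>

lemma DA_memI: "has_expansion f a \<Longrightarrow> DA_sequence a \<Longrightarrow> (\<And>k. a k \<in> F) \<Longrightarrow> f \<in> DA F"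
  unfolding DA_def DA_sequence_def by blast

lemma
  assumes "f \<in> DA F"
  shows DA_has_expansion: "has_expansion f (DA_coeff f)"
    and DA_coeff_sequence: "DA_sequence (DA_coeff f)"
    and DA_coeff_mem: "DA_coeff f k \<in> F"
proof -
  obtain a where a: "has_expansion f a" "DA_sequence a" "\<And>k. a k \<in> F"
    using assms by (auto simp: DA_def DA_sequence_def)
  have "DA_coeff f = a" using a(1) by (rule DA_coeff_eq)
  with a show "has_expansion f (DA_coeff f)" "DA_sequence (DA_coeff f)" "DA_coeff f k \<in> F"
    by simp_all
qed

lemma DA_mono: "f \<in> DA F \<Longrightarrow> F \<subseteq> G \<Longrightarrow> f \<in> DA G"
  unfolding DA_def by blast

lemma DA_UNIV: "f \<in> DA F \<Longrightarrow> f \<in> DA UNIV"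
  by (rule DA_mono) auto

lemma DA_coeff_inject:
  assumes "f \<in> DA F" "g \<in> DA G" "DA_coeff f = DA_coeff g"
  shows "f = g"
proof
  fix z
  have f: "has_expansion f (DA_coeff f)"
    using assms(1) by (rule DA_has_expansion)
  have g: "has_expansion g (DA_coeff f)"
    unfolding assms(3) using assms(2) by (rule DA_has_expansion)
  show "f z = g z"
  proof (cases "z \<in> ball 0 1")
    case True
    with f g have "((\<lambda>k. monomial k z *\<^sub>C DA_coeff f k) has_sum f z) UNIV"
      "((\<lambda>k. monomial k z *\<^sub>C DA_coeff f k) has_sum g z) UNIV"
      unfolding has_expansion_def by blast+
    then show ?thesis by (rule has_sum_unique)
  next
    case False
    with f g show ?thesis by (simp add: has_expansion_def)
  qed
qed

lemma DA_coeff_monomial_tensor: "DA_coeff (monomial_tensor k x) = (\<lambda>j. if j = k then x else 0)"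
  by (rule DA_coeff_eq[OF has_expansion_monomial_tensor])

lemma monomial_tensor_DA: "monomial_tensor k x \<in> DA UNIV"
  by (rule DA_memI[OF has_expansion_monomial_tensor DA_sequence_single]) simp

lemma DA_coeff_add:
  "f \<in> DA F \<Longrightarrow> g \<in> DA G \<Longrightarrow> DA_coeff (\<lambda>z. f z + g z) = (\<lambda>k. DA_coeff f k + DA_coeff g k)"
  by (rule DA_coeff_eq[OF has_expansion_add[OF DA_has_expansion DA_has_expansion]])

lemma DA_coeff_scaleC: "f \<in> DA F \<Longrightarrow> DA_coeff (\<lambda>z. c *\<^sub>C f z) = (\<lambda>k. c *\<^sub>C DA_coeff f k)"
  by (rule DA_coeff_eq[OF has_expansion_scaleC[OF DA_has_expansion]])

lemma DA_coeff_diff: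
  "f \<in> DA F \<Longrightarrow> g \<in> DA G \<Longrightarrow> DA_coeff (\<lambda>z. f z - g z) = (\<lambda>k. DA_coeff f k - DA_coeff g k)"
  by (rule DA_coeff_eq[OF has_expansion_diff[OF DA_has_expansion DA_has_expansion]])

lemma DA_add:
  "f \<in> DA F \<Longrightarrow> g \<in> DA F \<Longrightarrow> (\<And>x y. x \<in> F \<Longrightarrow> y \<in> F \<Longrightarrow> x + y \<in> F) \<Longrightarrow> (\<lambda>z. f z + g z) \<in> DA F"
  by (rule DA_memI[OF has_expansion_add[OF DA_has_expansion DA_has_expansion]
        DA_sequence_add[OF DA_coeff_sequence DA_coeff_sequence]]) (auto dest: DA_coeff_mem)

lemma DA_scaleC:
  "f \<in> DA F \<Longrightarrow> (\<And>x. x \<in> F \<Longrightarrow> c *\<^sub>C x \<in> F) \<Longrightarrow> (\<lambda>z. c *\<^sub>C f z) \<in> DA F"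
  by (rule DA_memI[OF has_expansion_scaleC[OF DA_has_expansion]
        DA_sequence_scaleC[OF DA_coeff_sequence]]) (auto dest: DA_coeff_mem)

lemma DA_diff: "f \<in> DA UNIV \<Longrightarrow> g \<in> DA UNIV \<Longrightarrow> (\<lambda>z. f z - g z) \<in> DA UNIV"
  using DA_add[of f UNIV, OF _ DA_scaleC[of g UNIV "- 1"]] by (simp add: scaleC_minus_one)

lemma DA_norm_nonneg [simp]: "DA_norm f \<ge> 0"
  by (simp add: DA_norm_def infsum_nonneg)

lemma DA_norm_squared: "(DA_norm f)\<^sup>2 = (\<Sum>\<^sub>\<infinity>k. (norm (DA_coeff f k))\<^sup>2 / multinomial k)"
  by (simp add: DA_norm_def infsum_nonneg)

lemma norm_DA_coeff_le:
  assumes "f \<in> DA F"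
  shows "norm (DA_coeff f k) \<le> sqrt (multinomial k) * DA_norm f"
proof -
  have "(norm (DA_coeff f k))\<^sup>2 / multinomial k \<le> (DA_norm f)\<^sup>2"
    using finite_sum_le_infsum[of "\<lambda>k. (norm (DA_coeff f k))\<^sup>2 / multinomial k" UNIV "{k}"]
      DA_coeff_sequence[OF assms]
    by (simp add: DA_norm_squared DA_sequence_def)
  then have "(norm (DA_coeff f k))\<^sup>2 \<le> (sqrt (multinomial k) * DA_norm f)\<^sup>2"
    by (simp add: power_mult_distrib divide_le_eq mult.commute)
  then show ?thesis by (rule power2_le_imp_le) simp
qed

lemma DA_norm_monomial_tensor: "DA_norm (monomial_tensor k x) = norm x / sqrt (multinomial k)"
proof -
  have "((\<lambda>j. (norm (if j = k then x else 0))\<^sup>2 / multinomial j) has_sum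
      (norm x)\<^sup>2 / multinomial k) UNIV"
    by (rule has_sum_finite_neutralI[of "{k}"]) auto
  then have "(\<Sum>\<^sub>\<infinity>j. (norm (if j = k then x else 0))\<^sup>2 / multinomial j) = (norm x)\<^sup>2 / multinomial k"
    by (rule infsumI)
  then show ?thesis
    by (simp add: DA_norm_def DA_coeff_monomial_tensor real_sqrt_divide)
qed

text \<open>
  Density of the vector-valued polynomials, phrased through the remainder after the terms with
  exponent in \<open>K\<close>.
\<close>

lemma DA_tail_small:
  fixes f :: "complex ^ 'm::finite \<Rightarrow> 'e::chilbert_space"
  assumes "f \<in> DA UNIV" "\<epsilon> > 0"
  obtains K where "finite K"
    "DA_norm (power_series (\<lambda>k. if k \<in> K then 0 else DA_coeff f k)) \<le> \<epsilon>"
proof -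
  define \<phi> where "\<phi> k = (norm (DA_coeff f k))\<^sup>2 / multinomial k" for k
  have "\<phi> summable_on UNIV"
    using DA_coeff_sequence[OF assms(1)] by (simp add: \<phi>_def[abs_def] DA_sequence_def)
  then have S: "(\<phi> has_sum infsum \<phi> UNIV) UNIV" by (rule has_sum_infsum)
  obtain K where K: "finite K" "dist (sum \<phi> K) (infsum \<phi> UNIV) \<le> \<epsilon>\<^sup>2"
    using has_sum_finite_approximation[OF S zero_less_power[OF assms(2)]] by blast
  let ?a = "\<lambda>k. if k \<in> K then 0 else DA_coeff f k"
  have "DA_sequence ?a"
    by (rule DA_sequence_le[OF DA_coeff_sequence[OF assms(1)]]) simp
  then have co: "DA_coeff (power_series ?a) = ?a"
    by (intro DA_coeff_eq has_expansion_power_series)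
  have "((\<lambda>k. if k \<in> K then \<phi> k else 0) has_sum sum \<phi> K) UNIV"
    using K by (intro has_sum_finite_neutralI[of K]) auto
  from has_sum_add[OF S has_sum_uminusI[OF this]]
  have sum: "((\<lambda>k. \<phi> k + - (if k \<in> K then \<phi> k else 0)) has_sum infsum \<phi> UNIV - sum \<phi> K) UNIV"
    unfolding diff_conv_add_uminus .
  have eq: "(\<lambda>k. \<phi> k + - (if k \<in> K then \<phi> k else 0)) = (\<lambda>k. (norm (?a k))\<^sup>2 / multinomial k)"
    by (auto simp: \<phi>_def)
  have "(DA_norm (power_series ?a))\<^sup>2 = infsum \<phi> UNIV - sum \<phi> K"
    unfolding DA_norm_squared co using sum unfolding eq by (rule infsumI)
  also have "\<dots> \<le> \<epsilon>\<^sup>2" using K(2) by (simp add: dist_real_def)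
  finally have "DA_norm (power_series ?a) \<le> \<epsilon>"
    by (rule power2_le_imp_le) (use assms(2) in simp)
  with K(1) show thesis by (rule that)
qed

section \<open>Coordinate multiplication and its adjoint\<close>

text \<open>
  Sums in which the exponent of \<open>z\<^sub>i\<close> is positive are reindexed over all exponents; this turns
  shifted coefficients back into unshifted ones.
\<close>

lemma has_sum_incr_iff:
  fixes G :: "('m \<Rightarrow> nat) \<Rightarrow> 'a::{comm_monoid_add, topological_space}"
  assumes "\<And>k. k i = 0 \<Longrightarrow> G k = 0"
  shows "(G has_sum s) UNIV \<longleftrightarrow> ((\<lambda>k. G (incr i k)) has_sum s) UNIV"
proof -
  have "(G has_sum s) UNIV \<longleftrightarrow> (G has_sum s) (range (incr i))"
    by (rule has_sum_cong_neutral) (auto simp: range_incr assms)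
  also have "\<dots> \<longleftrightarrow> ((\<lambda>k. G (incr i k)) has_sum s) UNIV"
    by (simp add: has_sum_reindex[OF inj_incr] o_def)
  finally show ?thesis .
qed

lemma infsum_incr:
  fixes G :: "('m \<Rightarrow> nat) \<Rightarrow> 'a::{comm_monoid_add, t2_space}"
  assumes "\<And>k. k i = 0 \<Longrightarrow> G k = 0"
  shows "infsum G UNIV = (\<Sum>\<^sub>\<infinity>k. G (incr i k))"
proof -
  have "infsum G UNIV = infsum G (range (incr i))"
    by (rule infsum_cong_neutral) (auto simp: range_incr assms)
  also have "\<dots> = (\<Sum>\<^sub>\<infinity>k. G (incr i k))"
    by (simp add: infsum_reindex[OF inj_incr] o_def)
  finally show ?thesis .
qed

definition shift :: "'m \<Rightarrow> (('m \<Rightarrow> nat) \<Rightarrow> 'e::zero) \<Rightarrow> ('m \<Rightarrow> nat) \<Rightarrow> 'e" where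
  "shift i a k = (if k i = 0 then 0 else a (decr i k))"

lemma shift_incr [simp]: "shift i a (incr i k) = a k"
  by (simp add: shift_def)

lemma shift_eq_0: "k i = 0 \<Longrightarrow> shift i a k = 0"
  by (simp add: shift_def)

lemma has_expansion_coord_mult:
  assumes "has_expansion f a"
  shows "has_expansion (coord_mult i f) (shift i a)"
proof -
  have "((\<lambda>k. monomial k z *\<^sub>C shift i a k) has_sum z $ i *\<^sub>C f z) UNIV"
    if "z \<in> ball 0 1" for z
  proof -
    have "((\<lambda>k. z $ i *\<^sub>C (monomial k z *\<^sub>C a k)) has_sum z $ i *\<^sub>C f z) UNIV"
      using assms that
      by (intro has_sum_bounded_linear[OF bounded_linear_scaleC]) (simp add: has_expansion_def)
    then show ?thesis
      by (subst has_sum_incr_iff[where i = i])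
        (simp_all add: shift_eq_0 monomial_incr scaleC_scaleC)
  qed
  then show ?thesis
    using assms by (simp add: has_expansion_def mult_op_def)
qed

lemma DA_sequence_incr_summable:
  "DA_sequence a \<Longrightarrow> (\<lambda>k. (norm (a k))\<^sup>2 / multinomial (incr i k)) summable_on UNIV"
  unfolding DA_sequence_def
  by (erule summable_on_comparison_test)
    (auto intro!: divide_left_mono multinomial_le_incr mult_pos_pos)

lemma DA_sequence_shift:
  assumes "DA_sequence a"
  shows "DA_sequence (shift i a)"
proof -
  obtain s where "((\<lambda>k. (norm (a k))\<^sup>2 / multinomial (incr i k)) has_sum s) UNIV"
    using DA_sequence_incr_summable[OF assms] by (auto simp: summable_on_def)
  then have "((\<lambda>k. (norm (shift i a k))\<^sup>2 / multinomial k) has_sum s) UNIV"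
    by (subst has_sum_incr_iff[where i = i]) (simp_all add: shift_eq_0)
  then show ?thesis
    unfolding DA_sequence_def by (rule has_sum_imp_summable)
qed

lemma DA_coord_mult:
  assumes "f \<in> DA F" "0 \<in> F"
  shows "coord_mult i f \<in> DA F"
  by (rule DA_memI[OF has_expansion_coord_mult[OF DA_has_expansion]
        DA_sequence_shift[OF DA_coeff_sequence]])
    (use assms DA_coeff_mem in \<open>auto simp: shift_def\<close>)

lemma DA_coeff_coord_mult:
  "f \<in> DA F \<Longrightarrow> DA_coeff (coord_mult i f) = shift i (DA_coeff f)"
  by (rule DA_coeff_eq[OF has_expansion_coord_mult[OF DA_has_expansion]])

lemma DA_norm_coord_mult_squared:
  assumes "f \<in> DA F"
  shows "(DA_norm (coord_mult i f))\<^sup>2 =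
    (\<Sum>\<^sub>\<infinity>k. (norm (DA_coeff f k))\<^sup>2 / multinomial (incr i k))"
  unfolding DA_norm_squared DA_coeff_coord_mult[OF assms]
  by (subst infsum_incr[where i = i]) (simp_all add: shift_eq_0)

lemma coord_mult_monomial_tensor:
  "coord_mult i (monomial_tensor k x) = monomial_tensor (incr i k) x"
  by (auto simp: mult_op_def monomial_tensor_def monomial_incr scaleC_scaleC fun_eq_iff)

text \<open>
  The action of \<open>M\<^sub>z\<^sub>i\<^sup>*\<close> on coefficients.
\<close>

definition weighted_backward_shift ::
    "'m::finite \<Rightarrow> (('m \<Rightarrow> nat) \<Rightarrow> 'e::complex_inner) \<Rightarrow> ('m \<Rightarrow> nat) \<Rightarrow> 'e" where
  "weighted_backward_shift i b k =
     complex_of_real (multinomial k / multinomial (incr i k)) *\<^sub>C b (incr i k)"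

text \<open>
  The backward shift is a contraction because the weights increase along \<open>incr i\<close>.
\<close>

lemma DA_sequence_weighted_backward_shift:
  assumes "DA_sequence b"
  shows "DA_sequence (weighted_backward_shift i b)"
  unfolding DA_sequence_def
proof (rule summable_on_comparison_test)
  have "(\<lambda>k. (norm (b k))\<^sup>2 / multinomial k) summable_on range (incr i)"
    using assms unfolding DA_sequence_def by (rule summable_on_subset_banach) simp
  then show "(\<lambda>k. (norm (b (incr i k)))\<^sup>2 / multinomial (incr i k)) summable_on UNIV"
    by (simp add: summable_on_reindex[OF inj_incr] o_def)
  fix k
  define p q where "p = multinomial k" and "q = multinomial (incr i k)"
  have pq: "0 < p" "p \<le> q" by (simp_all add: p_def q_def multinomial_le_incr)
  have "(norm (weighted_backward_shift i b k))\<^sup>2 / p = (p / q) * ((norm (b (incr i k)))\<^sup>2 / q)"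
    using pq by (simp add: weighted_backward_shift_def norm_scaleC power_mult_distrib
        power_divide norm_divide p_def[symmetric] q_def[symmetric] power2_eq_square)
  also have "\<dots> \<le> 1 * ((norm (b (incr i k)))\<^sup>2 / q)"
    using pq by (intro mult_right_mono) auto
  finally show "(norm (weighted_backward_shift i b k))\<^sup>2 / multinomial k \<le>
      (norm (b (incr i k)))\<^sup>2 / multinomial (incr i k)"
    by (simp add: p_def q_def)
qed simp

lemma DA_inner_monomial_tensor:
  "DA_inner (monomial_tensor k x) g = cinner x (DA_coeff g k) / complex_of_real (multinomial k)"
proof -
  have "((\<lambda>j. cinner (if j = k then x else 0) (DA_coeff g j) / complex_of_real (multinomial j))
      has_sum cinner x (DA_coeff g k) / complex_of_real (multinomial k)) UNIV"
    by (rule has_sum_finite_neutralI[of "{k}"]) auto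
  then show ?thesis
    unfolding DA_inner_def DA_coeff_monomial_tensor by (rule infsumI)
qed

text \<open>
  The two inner products agree term by term after reindexing; testing against the functions
  \<open>z\<^sup>k \<otimes> x\<close> shows that no other function of the module has this property.
\<close>

lemma DA_adjoint_coord_mult:
  fixes g :: "complex ^ 'm::finite \<Rightarrow> 'e::chilbert_space"
  assumes g: "g \<in> DA UNIV"
  shows "DA_adjoint (coord_mult i) g = power_series (weighted_backward_shift i (DA_coeff g))"
  unfolding DA_adjoint_def
proof (rule the_equality)
  define h where "h = power_series (weighted_backward_shift i (DA_coeff g))"
  have seq: "DA_sequence (weighted_backward_shift i (DA_coeff g))"
    by (rule DA_sequence_weighted_backward_shift[OF DA_coeff_sequence[OF g]])
  then have hexp: "has_expansion h (weighted_backward_shift i (DA_coeff g))"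
    unfolding h_def by (rule has_expansion_power_series)
  have h: "h \<in> DA UNIV"
    by (rule DA_memI[OF hexp seq]) simp
  have "DA_inner (coord_mult i f) g = DA_inner f h" if "f \<in> DA UNIV" for f
  proof -
    have "DA_inner (coord_mult i f) g =
        (\<Sum>\<^sub>\<infinity>k. cinner (DA_coeff f k) (DA_coeff g (incr i k)) / complex_of_real (multinomial (incr i k)))"
      unfolding DA_inner_def DA_coeff_coord_mult[OF that]
      by (subst infsum_incr[where i = i]) (simp_all add: shift_eq_0)
    also have "\<dots> = DA_inner f h"
      unfolding DA_inner_def DA_coeff_eq[OF hexp] weighted_backward_shift_def cinner_scaleC_right
      by simp
    finally show ?thesis .
  qed
  with h show "power_series (weighted_backward_shift i (DA_coeff g)) \<in> DA UNIV \<and>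
      (\<forall>f\<in>DA UNIV. DA_inner (coord_mult i f) g =
        DA_inner f (power_series (weighted_backward_shift i (DA_coeff g))))"
    by (simp add: h_def)
  fix h'
  assume h': "h' \<in> DA UNIV \<and> (\<forall>f\<in>DA UNIV. DA_inner (coord_mult i f) g = DA_inner f h')"
  have "DA_coeff h' k = DA_coeff h k" for k
  proof -
    let ?x = "DA_coeff h' k - DA_coeff h k"
    have "DA_inner (monomial_tensor k ?x) h' = DA_inner (monomial_tensor k ?x) h"
      using h' \<open>\<And>f. f \<in> DA UNIV \<Longrightarrow> DA_inner (coord_mult i f) g = DA_inner f h\<close>
      by (metis monomial_tensor_DA)
    then have "cinner ?x ?x = 0"
      by (simp add: DA_inner_monomial_tensor cinner_diff_right)
    then show ?thesis by (simp add: cinner_self_eq_zero)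
  qed
  then have "h' = h"
    using DA_coeff_inject[OF conjunct1[OF h'] h] by blast
  then show "h' = power_series (weighted_backward_shift i (DA_coeff g))"
    by (simp add: h_def)
qed

text \<open>
  Coordinate multiplication and its adjoint only move and rescale coefficients, so they preserve the
  condition that all coefficients lie in \<open>F\<close>. The condition passes to limits because each coefficient depends
  continuously on the function.
\<close>

lemma DA_reducing_submodule_DA:
  fixes F :: "'e::chilbert_space set"
  assumes zero: "0 \<in> F"
    and add: "\<And>x y. x \<in> F \<Longrightarrow> y \<in> F \<Longrightarrow> x + y \<in> F"
    and scale: "\<And>c x. x \<in> F \<Longrightarrow> c *\<^sub>C x \<in> F"
    and closed: "closed F"
  shows "DA_reducing_submodule (DA F :: (complex ^ 'm::finite \<Rightarrow> 'e) set)"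
  unfolding DA_reducing_submodule_def DA_submodule_def DA_closed_subspace_def
proof (intro conjI allI ballI impI)
  show "DA F \<subseteq> (DA UNIV :: (complex ^ 'm \<Rightarrow> 'e) set)" by (auto intro: DA_UNIV)
  have "DA_sequence (\<lambda>k :: 'm \<Rightarrow> nat. 0 :: 'e)" by (simp add: DA_sequence_def)
  then show "(\<lambda>z. 0) \<in> (DA F :: (complex ^ 'm \<Rightarrow> 'e) set)"
    by (rule DA_memI[OF has_expansion_zero]) (rule zero)
  fix f g :: "complex ^ 'm \<Rightarrow> 'e" and c i
  show "(\<lambda>z. f z + g z) \<in> DA F" if "f \<in> DA F" "g \<in> DA F"
    using that add by (rule DA_add)
  show "(\<lambda>z. c *\<^sub>C f z) \<in> DA F" if "f \<in> DA F"
    using that scale by (rule DA_scaleC)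
  show "coord_mult i f \<in> DA F" if "f \<in> DA F"
    using that zero by (rule DA_coord_mult)
  show "DA_adjoint (coord_mult i) f \<in> DA F" if f: "f \<in> DA F"
  proof -
    have seq: "DA_sequence (weighted_backward_shift i (DA_coeff f))"
      by (rule DA_sequence_weighted_backward_shift[OF DA_coeff_sequence[OF f]])
    show ?thesis
      unfolding DA_adjoint_coord_mult[OF DA_UNIV[OF f]]
      by (rule DA_memI[OF has_expansion_power_series[OF seq] seq])
        (auto simp: weighted_backward_shift_def intro!: scale DA_coeff_mem[OF f])
  qed
next
  fix s and f :: "complex ^ 'm \<Rightarrow> 'e"
  assume f: "f \<in> DA UNIV"
    and s: "(\<forall>n::nat. s n \<in> DA F) \<and> (\<lambda>n. DA_norm (\<lambda>z. s n z - f z)) \<longlonglongrightarrow> 0"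
  have "DA_coeff f k \<in> F" for k
  proof (rule closed_sequentially[OF closed])
    show "DA_coeff (s n) k \<in> F" for n
      using s DA_coeff_mem by blast
    have "(\<lambda>n. DA_coeff (s n) k - DA_coeff f k) \<longlonglongrightarrow> 0"
    proof (rule Lim_null_comparison)
      show "\<forall>\<^sub>F n in sequentially. norm (DA_coeff (s n) k - DA_coeff f k) \<le>
          sqrt (multinomial k) * DA_norm (\<lambda>z. s n z - f z)"
      proof (intro always_eventually allI)
        fix n
        have "s n \<in> DA UNIV" using s DA_UNIV by blast
        then show "norm (DA_coeff (s n) k - DA_coeff f k) \<le>
            sqrt (multinomial k) * DA_norm (\<lambda>z. s n z - f z)"
          using norm_DA_coeff_le[OF DA_diff[of "s n" f]] f by (simp add: DA_coeff_diff)
      qed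
      show "(\<lambda>n. sqrt (multinomial k) * DA_norm (\<lambda>z. s n z - f z)) \<longlonglongrightarrow> 0"
        using tendsto_mult_right_zero s by blast
    qed
    then show "(\<lambda>n. DA_coeff (s n) k) \<longlonglongrightarrow> DA_coeff f k"
      by (simp add: LIM_zero_iff)
  qed
  then show "f \<in> DA F"
    by (rule DA_memI[OF DA_has_expansion[OF f] DA_coeff_sequence[OF f]])
qed

section \<open>Isometric module maps\<close>

lemma has_sum_finite_sum:
  fixes f :: "'i \<Rightarrow> 'k \<Rightarrow> 'a::topological_comm_monoid_add"
  assumes "finite I" "\<And>i. i \<in> I \<Longrightarrow> (f i has_sum s i) A"
  shows "((\<lambda>x. \<Sum>i\<in>I. f i x) has_sum (\<Sum>i\<in>I. s i)) A"
  using assms by (induction I rule: finite_induct) (auto intro!: has_sum_add)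

text \<open>
  The equalities \<open>\<Sum>\<^sub>i \<parallel>z\<^sub>i f\<parallel>\<^sup>2 = m \<parallel>f\<parallel>\<^sup>2\<close> say that weighting \<open>\<parallel>a\<^sub>k\<parallel>\<^sup>2 / \<gamma>\<^sub>k\<close> with
  \<open>(\<bar>k\<bar> + m) / (\<bar>k\<bar> + 1)\<close> or with \<open>m\<close> gives the same sum. The second weight is strictly larger
  in positive degree, so only the constant term can survive.
\<close>

lemma DA_coeff_eq_0_if_coord_mult_isometric:
  fixes f :: "complex ^ 'm::finite \<Rightarrow> 'e::complex_inner"
  assumes f: "f \<in> DA UNIV" and card: "CARD('m) > 1"
    and iso: "\<And>i. DA_norm (coord_mult i f) = DA_norm f"
    and k: "k \<noteq> (\<lambda>_. 0)"
  shows "DA_coeff f k = 0"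
proof -
  define w where "w k = (norm (DA_coeff f k))\<^sup>2" for k
  define N where "N = (DA_norm f)\<^sup>2"
  define m where "m = real CARD('m)"
  define d where "d k = real (total_degree k)" for k :: "'m \<Rightarrow> nat"
  note seq = DA_coeff_sequence[OF f]
  have "((\<lambda>k. w k / multinomial k) has_sum N) UNIV"
    using has_sum_infsum[OF seq[unfolded DA_sequence_def]]
    by (simp add: w_def N_def DA_norm_squared)
  then have 1: "((\<lambda>k. m * (w k / multinomial k)) has_sum m * N) UNIV"
    by (rule has_sum_cmult_right)
  have "((\<lambda>k. w k / multinomial (incr i k)) has_sum N) UNIV" for i
    using has_sum_infsum[OF DA_sequence_incr_summable[OF seq, of i]] iso[of i]
      DA_norm_coord_mult_squared[OF f, of i]
    by (simp add: w_def N_def)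
  then have "((\<lambda>k. \<Sum>i\<in>UNIV. w k / multinomial (incr i k)) has_sum (\<Sum>i\<in>(UNIV :: 'm set). N)) UNIV"
    by (intro has_sum_finite_sum) auto
  moreover have "(\<Sum>i\<in>UNIV. w k / multinomial (incr i k)) =
      w k * ((d k + m) / ((d k + 1) * multinomial k))" for k
    using sum_inverse_multinomial_incr[of k]
    by (simp add: d_def m_def sum_distrib_left[symmetric] divide_inverse)
  ultimately have 2: "((\<lambda>k. w k * ((d k + m) / ((d k + 1) * multinomial k))) has_sum m * N) UNIV"
    by (simp add: m_def)
  define \<psi> where "\<psi> k = w k * ((m - 1) * d k / ((d k + 1) * multinomial k))" for k
  have "m * (w k / multinomial k) + - (w k * ((d k + m) / ((d k + 1) * multinomial k))) = \<psi> k" for k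
  proof -
    have "m * (u / g) + - (u * ((e + m) / (c * g))) = u * ((m - 1) * e / (c * g))"
      if "c = e + 1" "c \<noteq> 0" "g \<noteq> 0" for u g e c :: real
      using that(2,3) by (simp add: field_simps) (simp add: that(1) algebra_simps)
    moreover have "d k + 1 \<noteq> 0" by (simp add: d_def add_nonneg_eq_0_iff)
    ultimately show ?thesis by (simp add: \<psi>_def)
  qed
  then have "(\<psi> has_sum 0) UNIV"
    using has_sum_add[OF 1 has_sum_uminusI[OF 2]] by simp
  moreover have "\<psi> k \<ge> 0" for k
    using card by (simp add: \<psi>_def w_def d_def m_def)
  ultimately have "\<psi> k = 0"
    by (intro nonneg_has_sum_le_0D[where f = \<psi> and A = UNIV and a = 0]) auto
  moreover have "d k > 0"
    using k total_degree_eq_0_iff[of k] by (simp add: d_def)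
  ultimately have "w k = 0"
    using card by (simp add: \<psi>_def m_def)
  then show ?thesis by (simp add: w_def)
qed

lemma closed_range_clinear_isometry:
  fixes T :: "'e::chilbert_space \<Rightarrow> 'f::complex_inner"
  assumes "clinear_isometry T"
  shows "closed (range T)"
proof (rule complete_imp_closed, rule complete_isometric_image[of 1])
  show "bounded_linear T"
    using assms unfolding clinear_isometry_def clinear_map_def
    by (intro bounded_linear_intro[where K = 1]) (simp_all add: scaleR_scaleC)
qed (use assms in \<open>auto simp: clinear_isometry_def complete_UNIV\<close>)

text \<open>
  The difference \<open>D\<close> of the two sides is additive and continuous in \<open>f\<close> and vanishes on the
  functions \<open>z\<^sup>k \<otimes> x\<close>. Hence \<open>D\<close> does not change when finitely many terms are removed from
  the expansion of \<open>f\<close>, and the remainder is arbitrarily small.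
\<close>

lemma DA_coeff_bounded_clinear:
  fixes V :: "(complex ^ 'm::finite \<Rightarrow> 'e::chilbert_space) \<Rightarrow> (complex ^ 'm \<Rightarrow> 'f::chilbert_space)"
  assumes V: "DA_bounded_clinear V" and V0: "clinear_isometry V0"
    and VV0: "\<And>k x. V (monomial_tensor k x) = monomial_tensor k (V0 x)"
    and f: "f \<in> DA UNIV"
  shows "DA_coeff (V f) l = V0 (DA_coeff f l)"
proof -
  define D where "D g = DA_coeff (V g) l - V0 (DA_coeff g l)" for g
  have V0_add: "V0 (x + y) = V0 x + V0 y" and V0_norm: "norm (V0 x) = norm x" for x y
    using V0 by (auto simp: clinear_isometry_def clinear_map_def)
  have V0_0: "V0 0 = 0" using V0_norm[of 0] by simp
  have VDA: "V g \<in> DA UNIV" if "g \<in> DA UNIV" for g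
    using V that by (simp add: DA_bounded_clinear_def)
  obtain C where C: "\<And>g. g \<in> DA UNIV \<Longrightarrow> DA_norm (V g) \<le> C * DA_norm g"
    using V unfolding DA_bounded_clinear_def by blast
  have D_add: "D (\<lambda>z. g z + h z) = D g + D h" if "g \<in> DA UNIV" "h \<in> DA UNIV" for g h
  proof -
    have "V (\<lambda>z. g z + h z) = (\<lambda>z. V g z + V h z)"
      using V that unfolding DA_bounded_clinear_def by blast
    then show ?thesis
      using that by (simp add: D_def DA_coeff_add[OF VDA VDA] DA_coeff_add V0_add)
  qed
  have D_monomial: "D (monomial_tensor k x) = 0" for k x
    by (simp add: D_def VV0 DA_coeff_monomial_tensor V0_0)
  define M where "M = sqrt (multinomial l) * (C + 1)"
  have D_bound: "norm (D g) \<le> M * DA_norm g" if g: "g \<in> DA UNIV" for g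
  proof -
    have "norm (D g) \<le> norm (DA_coeff (V g) l) + norm (DA_coeff g l)"
      using norm_triangle_ineq4[of "DA_coeff (V g) l" "V0 (DA_coeff g l)"]
      by (simp add: D_def V0_norm)
    also have "\<dots> \<le> sqrt (multinomial l) * DA_norm (V g) + sqrt (multinomial l) * DA_norm g"
      by (intro add_mono norm_DA_coeff_le[OF VDA[OF g]] norm_DA_coeff_le[OF g])
    also have "\<dots> \<le> sqrt (multinomial l) * (C * DA_norm g) + sqrt (multinomial l) * DA_norm g"
      by (intro add_right_mono mult_left_mono C[OF g]) simp
    finally show ?thesis by (simp add: M_def algebra_simps)
  qed
  define tail where "tail K = power_series (\<lambda>k. if k \<in> K then 0 else DA_coeff f k)" for K
  have seq: "DA_sequence (\<lambda>k. if k \<in> K then 0 else DA_coeff f k)" for K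
    by (rule DA_sequence_le[OF DA_coeff_sequence[OF f]]) simp
  have tail_exp: "has_expansion (tail K) (\<lambda>k. if k \<in> K then 0 else DA_coeff f k)" for K
    unfolding tail_def by (rule has_expansion_power_series[OF seq])
  have tail_DA: "tail K \<in> DA UNIV" for K
    by (rule DA_memI[OF tail_exp seq]) simp
  have D_tail: "D f = D (tail K)" if "finite K" for K
    using that
  proof (induction K rule: finite_induct)
    case empty
    have "tail {} = f"
      by (rule DA_coeff_inject[OF tail_DA f]) (simp add: DA_coeff_eq[OF tail_exp])
    then show ?case by simp
  next
    case (insert k K)
    have "tail K = (\<lambda>z. monomial_tensor k (DA_coeff f k) z + tail (insert k K) z)"
    proof (rule DA_coeff_inject[OF tail_DA DA_add[OF monomial_tensor_DA tail_DA]])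
      show "DA_coeff (tail K) =
          DA_coeff (\<lambda>z. monomial_tensor k (DA_coeff f k) z + tail (insert k K) z)"
        using insert.hyps
        by (auto simp: DA_coeff_add[OF monomial_tensor_DA tail_DA] DA_coeff_eq[OF tail_exp]
            DA_coeff_monomial_tensor)
    qed simp
    then have "D (tail K) = D (tail (insert k K))"
      using D_add[OF monomial_tensor_DA tail_DA] D_monomial by simp
    with insert.IH show ?case by simp
  qed
  have "norm (D f) \<le> e" if e: "e > 0" for e
  proof -
    have "e / (\<bar>M\<bar> + 1) > 0" using e by (simp add: add_nonneg_pos)
    from DA_tail_small[OF f this] obtain K where K: "finite K" "DA_norm (tail K) \<le> e / (\<bar>M\<bar> + 1)"
      unfolding tail_def by blast
    have "norm (D f) \<le> M * DA_norm (tail K)"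
      unfolding D_tail[OF K(1)] by (rule D_bound[OF tail_DA])
    also have "\<dots> \<le> (\<bar>M\<bar> + 1) * DA_norm (tail K)"
      by (intro mult_right_mono) auto
    also have "\<dots> \<le> (\<bar>M\<bar> + 1) * (e / (\<bar>M\<bar> + 1))"
      by (rule mult_left_mono[OF K(2)]) simp
    also have "\<dots> = e"
      using abs_ge_zero[of M] by (simp del: abs_ge_zero)
    finally show ?thesis .
  qed
  then have "norm (D f) \<le> 0 + e" if "e > 0" for e
    using that by simp
  then have "norm (D f) \<le> 0" by (rule field_le_epsilon)
  then show ?thesis by (simp add: D_def)
qed

lemma monomial_polynomial_function: "monomial k \<in> polynomial_functions"
  unfolding polynomial_functions_def
  by (intro CollectI exI[of _ "{k}"] exI[of _ "\<lambda>_. 1"]) auto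

lemma coordinate_polynomial_function: "(\<lambda>z. z $ i) \<in> polynomial_functions"
proof -
  have "monomial (incr i (\<lambda>_. 0)) z = z $ i" for z
    using monomial_incr[of "\<lambda>_. 0" i z] by simp
  then have "(\<lambda>z. z $ i) = monomial (incr i (\<lambda>_. 0))"
    by (simp add: fun_eq_iff)
  then show ?thesis by (simp add: monomial_polynomial_function)
qed

lemma mult_op_monomial_constant:
  "mult_op (monomial k) (monomial_tensor (\<lambda>_. 0) x) = monomial_tensor k x"
  by (auto simp: mult_op_def monomial_tensor_def scaleC_one)

theorem theorem4p1:
  fixes V :: "(complex ^ 'm::finite \<Rightarrow> 'e::chilbert_space) \<Rightarrow>
              (complex ^ 'm \<Rightarrow> 'f::chilbert_space)"
  assumes "CARD('m) > 1"
    and "DA_module_map V"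
    and "DA_isometric V"
  shows "\<exists>V0 :: 'e \<Rightarrow> 'f. clinear_isometry V0 \<and>
           (\<forall>k x. V (monomial_tensor k x) = monomial_tensor k (V0 x)) \<and>
           DA_reducing_submodule (V ` DA UNIV) \<and>
           V ` DA UNIV = DA (range V0)"
proof -
  define V0 where "V0 x = DA_coeff (V (monomial_tensor (\<lambda>_. 0) x)) (\<lambda>_. 0)" for x
  have bounded: "DA_bounded_clinear V"
    using assms(2) by (simp add: DA_module_map_def)
  have VDA: "V f \<in> DA UNIV" if "f \<in> DA UNIV" for f
    using bounded that by (simp add: DA_bounded_clinear_def)
  have V_add: "V (\<lambda>z. f z + g z) = (\<lambda>z. V f z + V g z)"
    if "f \<in> DA UNIV" "g \<in> DA UNIV" for f g
    using bounded that by (simp add: DA_bounded_clinear_def)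
  have V_scale: "V (\<lambda>z. c *\<^sub>C f z) = (\<lambda>z. c *\<^sub>C V f z)" if "f \<in> DA UNIV" for c f
    using bounded that by (simp add: DA_bounded_clinear_def)
  have module: "V (mult_op p f) = mult_op p (V f)" if "p \<in> polynomial_functions" "f \<in> DA UNIV" for p f
    using assms(2) that by (simp add: DA_module_map_def)
  have iso: "DA_norm (V f) = DA_norm f" if "f \<in> DA UNIV" for f
    using assms(3) that by (simp add: DA_isometric_def)
  \<comment> \<open>\<open>M\<^sub>z\<^sub>i\<close> preserves the norm of constants, because \<open>\<gamma> = 1\<close> in degree \<open>1\<close>. Since \<open>V\<close> is isometric and
    commutes with \<open>M\<^sub>z\<^sub>i\<close>, the latter also preserves the norm of images of constants.\<close>
  have V_const: "V (monomial_tensor (\<lambda>_. 0) x) = monomial_tensor (\<lambda>_. 0) (V0 x)" for x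
  proof (rule DA_coeff_inject[OF VDA[OF monomial_tensor_DA] monomial_tensor_DA])
    let ?f = "V (monomial_tensor (\<lambda>_. 0) x)"
    have "DA_norm (coord_mult i ?f) = DA_norm ?f" for i
    proof -
      have "coord_mult i ?f = V (monomial_tensor (incr i (\<lambda>_. 0)) x)"
        using module[OF coordinate_polynomial_function[of i] monomial_tensor_DA, of "\<lambda>_. 0" x]
        by (simp only: coord_mult_monomial_tensor)
      moreover have "multinomial (incr i (\<lambda>_. 0)) = 1"
        using multinomial_incr[of "\<lambda>_. 0" i] by (simp add: total_degree_def)
      ultimately show ?thesis
        by (simp add: iso[OF monomial_tensor_DA] DA_norm_monomial_tensor)
    qed
    then have "DA_coeff ?f k = 0" if "k \<noteq> (\<lambda>_. 0)" for k
      by (rule DA_coeff_eq_0_if_coord_mult_isometric[OF VDA[OF monomial_tensor_DA] assms(1) _ that])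
    then show "DA_coeff ?f = DA_coeff (monomial_tensor (\<lambda>_. 0) (V0 x))"
      by (auto simp: DA_coeff_monomial_tensor V0_def)
  qed
  have V_monomial: "V (monomial_tensor k x) = monomial_tensor k (V0 x)" for k x
    using module[OF monomial_polynomial_function monomial_tensor_DA, of k "\<lambda>_. 0" x]
    by (simp add: V_const mult_op_monomial_constant)
  have V0_isometry: "clinear_isometry V0"
    unfolding clinear_isometry_def clinear_map_def
  proof (intro conjI allI)
    fix x y :: 'e and c
    have "monomial_tensor (\<lambda>_ :: 'm. 0) (x + y) =
        (\<lambda>z. monomial_tensor (\<lambda>_. 0) x z + monomial_tensor (\<lambda>_. 0) y z)"
      by (auto simp: monomial_tensor_def scaleC_add_right)
    moreover have "V (\<lambda>z. monomial_tensor (\<lambda>_. 0) x z + monomial_tensor (\<lambda>_. 0) y z) =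
        (\<lambda>z. V (monomial_tensor (\<lambda>_. 0) x) z + V (monomial_tensor (\<lambda>_. 0) y) z)"
      by (rule V_add[OF monomial_tensor_DA monomial_tensor_DA])
    ultimately show "V0 (x + y) = V0 x + V0 y"
      by (simp add: V0_def DA_coeff_add[OF VDA[OF monomial_tensor_DA] VDA[OF monomial_tensor_DA]])
    have "monomial_tensor (\<lambda>_ :: 'm. 0) (c *\<^sub>C x) = (\<lambda>z. c *\<^sub>C monomial_tensor (\<lambda>_. 0) x z)"
      by (auto simp: monomial_tensor_def scaleC_scaleC mult.commute)
    moreover have "V (\<lambda>z. c *\<^sub>C monomial_tensor (\<lambda>_. 0) x z) =
        (\<lambda>z. c *\<^sub>C V (monomial_tensor (\<lambda>_. 0) x) z)"
      by (rule V_scale[OF monomial_tensor_DA])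
    ultimately show "V0 (c *\<^sub>C x) = c *\<^sub>C V0 x"
      by (simp add: V0_def DA_coeff_scaleC[OF VDA[OF monomial_tensor_DA]])
    show "norm (V0 x) = norm x"
      using iso[OF monomial_tensor_DA, of "\<lambda>_. 0" x] by (simp add: V_const DA_norm_monomial_tensor)
  qed
  note V_coeff = DA_coeff_bounded_clinear[OF bounded V0_isometry V_monomial]
  have range: "V ` DA UNIV = DA (range V0)"
  proof (intro equalityI subsetI)
    fix g :: "complex ^ 'm \<Rightarrow> 'f" assume "g \<in> V ` DA UNIV"
    then obtain f where f: "f \<in> DA UNIV" and g: "g = V f" by blast
    have "V f \<in> DA (range V0)"
      by (rule DA_memI[OF DA_has_expansion[OF VDA[OF f]] DA_coeff_sequence[OF VDA[OF f]]])
        (simp add: V_coeff[OF f])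
    then show "g \<in> DA (range V0)" by (simp add: g)
  next
    fix g :: "complex ^ 'm \<Rightarrow> 'f" assume g: "g \<in> DA (range V0)"
    have "\<forall>k. \<exists>x. DA_coeff g k = V0 x"
      using DA_coeff_mem[OF g] by blast
    then obtain a where a: "\<And>k. DA_coeff g k = V0 (a k)"
      by (auto dest: choice)
    \<comment> \<open>The preimage is synthesised from coefficientwise preimages, which inherit summability.\<close>
    have "norm (a k) = norm (DA_coeff g k)" for k
      using V0_isometry by (simp add: a clinear_isometry_def)
    then have seq: "DA_sequence a"
      by (intro DA_sequence_le[OF DA_coeff_sequence[OF g]]) simp
    note exp = has_expansion_power_series[OF seq]
    have f: "power_series a \<in> DA UNIV" by (rule DA_memI[OF exp seq]) simp
    have "V (power_series a) = g"
      by (rule DA_coeff_inject[OF VDA[OF f] g], rule ext)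
        (simp add: V_coeff[OF f] DA_coeff_eq[OF exp] a)
    then show "g \<in> V ` DA UNIV" using f by (rule image_eqI[OF sym])
  qed
  have subspace: "0 \<in> range V0" "\<And>x y. x \<in> range V0 \<Longrightarrow> y \<in> range V0 \<Longrightarrow> x + y \<in> range V0"
    "\<And>c x. x \<in> range V0 \<Longrightarrow> c *\<^sub>C x \<in> range V0"
  proof -
    have lin: "V0 (x + y) = V0 x + V0 y" "V0 (c *\<^sub>C x) = c *\<^sub>C V0 x" for x y c
      using V0_isometry by (simp_all add: clinear_isometry_def clinear_map_def)
    show "0 \<in> range V0" using lin(2)[of 0 0] by (metis rangeI scaleC_zero_left)
    show "x + y \<in> range V0" if "x \<in> range V0" "y \<in> range V0" for x y
      using that by (auto simp: lin(1)[symmetric])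
    show "c *\<^sub>C x \<in> range V0" if "x \<in> range V0" for c x
      using that by (auto simp: lin(2)[symmetric])
  qed
  have "DA_reducing_submodule (V ` DA UNIV)"
    unfolding range
    by (rule DA_reducing_submodule_DA[OF subspace closed_range_clinear_isometry[OF V0_isometry]])
  then show ?thesis
    by (intro exI[of _ V0] conjI allI V0_isometry V_monomial range)
qed

end
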